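(* Suppose that $A,B,X\in \mathbb{C}^{n\times n}$ are all Hermitian positive semi-definite. Let $G=(A+X):B-A:B$. Then $$\Vert G\Vert\le \frac{\Vert (A+B)^\dagger B\Vert^2\cdot\Vert A+B\Vert\cdot \Vert X\Vert}{\Vert A+B\Vert+\Vert X\Vert},$$ where the right-hand side is read as $0$ if $\Vert A+B\Vert+\Vert X\Vert=0$.
   Context: $\mathbb{C}^{n\times n}$ is the set of $n\times n$ complex matrices; $\Vert M\Vert$ is the 2-norm (spectral/operator norm) of $M$. $M^\dagger$ denotes the Moore-Penrose inverse of $M$, i.e. the unique matrix satisfying $MM^\dagger M=M$, $M^\dagger MM^\dagger=M^\dagger$, $(MM^\dagger)^*=MM^\dagger$, $(M^\dagger M)^*=M^\dagger M$. The parallel sum of Hermitian positive semi-definite matrices $P,Q\in\mathbb{C}^{n\times n}$ is $P:Q=P(P+Q)^\dagger Q$. *)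

theory Defs
  imports "HOL-Analysis.Analysis"
begin

definition conj_transpose :: "complex^'n^'m \<Rightarrow> complex^'m^'n" where
  "conj_transpose M = (\<chi> i j. cnj (M $ j $ i))"

definition hermitian :: "complex^'n^'n \<Rightarrow> bool" where
  "hermitian M \<longleftrightarrow> conj_transpose M = M"

text \<open>The quadratic form of a Hermitian matrix is real-valued, so taking the real part
  below loses nothing.\<close>

definition hermitian_psd :: "complex^'n^'n \<Rightarrow> bool" where
  "hermitian_psd M \<longleftrightarrow>
     hermitian M \<and> (\<forall>x. 0 \<le> Re (\<Sum>i\<in>UNIV. cnj (x $ i) * (M *v x) $ i))"

text \<open>The norm on \<^typ>\<open>complex^'n\<close> is the Euclidean one, so the induced operator norm is the
  spectral norm.\<close>

definition spectral_norm :: "complex^'n^'m \<Rightarrow> real" where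
  "spectral_norm M = onorm ((*v) M)"

definition is_moore_penrose :: "complex^'n^'m \<Rightarrow> complex^'m^'n \<Rightarrow> bool" where
  "is_moore_penrose M N \<longleftrightarrow>
     M ** N ** M = M \<and> N ** M ** N = N \<and>
     conj_transpose (M ** N) = M ** N \<and> conj_transpose (N ** M) = N ** M"

definition moore_penrose :: "complex^'n^'m \<Rightarrow> complex^'m^'n" where
  "moore_penrose M = (THE N. is_moore_penrose M N)"

definition parallel_sum :: "complex^'n^'n \<Rightarrow> complex^'n^'n \<Rightarrow> complex^'n^'n" where
  "parallel_sum P Q = P ** moore_penrose (P + Q) ** Q"

lemma conj_transpose_mult: "conj_transpose (M ** N) = conj_transpose N ** conj_transpose M"
  by (simp add: conj_transpose_def matrix_matrix_mult_def vec_eq_iff mult.commute)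

lemma is_moore_penrose_unique:
  assumes "is_moore_penrose M N" "is_moore_penrose M K"
  shows "N = K"
proof -
  have N: "M ** N ** M = M" "N ** M ** N = N"
      "conj_transpose (M ** N) = M ** N" "conj_transpose (N ** M) = N ** M"
    and K: "M ** K ** M = M" "K ** M ** K = K"
      "conj_transpose (M ** K) = M ** K" "conj_transpose (K ** M) = K ** M"
    using assms by (auto simp: is_moore_penrose_def)
  have "M ** K = (M ** N) ** (M ** K)"
    by (simp add: matrix_mul_assoc N(1))
  then have "M ** K = conj_transpose ((M ** N) ** (M ** K))"
    using K(3) by simp
  also have "\<dots> = (M ** K) ** (M ** N)"
    by (simp add: conj_transpose_mult[of "M ** N" "M ** K"] N(3) K(3))
  also have "\<dots> = M ** N"
    by (simp add: matrix_mul_assoc K(1))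
  finally have MK: "M ** K = M ** N" .
  have "K ** M = (K ** M) ** (N ** M)"
    by (metis matrix_mul_assoc N(1))
  then have "K ** M = conj_transpose ((K ** M) ** (N ** M))"
    using K(4) by simp
  also have "\<dots> = (N ** M) ** (K ** M)"
    by (simp add: conj_transpose_mult[of "K ** M" "N ** M"] N(4) K(4))
  also have "\<dots> = N ** M"
    by (metis matrix_mul_assoc K(1))
  finally have KM: "K ** M = N ** M" .
  show ?thesis
    by (metis MK KM N(2) K(2) matrix_mul_assoc)
qed

lemma moore_penrose_eqI: "is_moore_penrose M N \<Longrightarrow> moore_penrose M = N"
  unfolding moore_penrose_def by (blast intro: the_equality is_moore_penrose_unique)

end

theory Submission
  imports Defs
begin

text \<open>Put \<open>S = A + B\<close> and \<open>K = S\<^sup>\<dagger> B\<close>. As \<open>ker S \<subseteq> ker B\<close>, we have \<open>B = S K\<close> and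
  \<open>A : B = B - B S\<^sup>\<dagger> B\<close>, and likewise for \<open>A + X\<close>, so that
  \<open>G = B (S\<^sup>\<dagger> - (S + X)\<^sup>\<dagger>) B = K\<^sup>* (X : S) K\<close>. The form of \<open>X : S\<close> at \<open>z\<close> is the minimum over
  \<open>u\<close> of \<open>\<langle>u, X u\<rangle> + \<langle>z - u, S (z - u)\<rangle>\<close>, and \<open>u = t z\<close> with
  \<open>t = \<parallel>S\<parallel> / (\<parallel>S\<parallel> + \<parallel>X\<parallel>)\<close> gives \<open>\<parallel>X : S\<parallel> \<le> \<parallel>S\<parallel> \<parallel>X\<parallel> / (\<parallel>S\<parallel> + \<parallel>X\<parallel>)\<close>. The inner product used
  throughout is the real one, the real part of the Hermitian product.\<close>

section \<open>Adjoints for the real inner product\<close>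

lemma inner_eq_Re_sum:
  fixes x y :: "complex^'n"
  shows "x \<bullet> y = Re (\<Sum>i\<in>UNIV. cnj (x $ i) * y $ i)"
  by (simp add: inner_vec_def inner_complex_def)

lemma conj_transpose_conj_transpose [simp]: "conj_transpose (conj_transpose M) = M"
  by (simp add: conj_transpose_def vec_eq_iff)

lemma conj_transpose_add: "conj_transpose (M + N) = conj_transpose M + conj_transpose N"
  by (simp add: conj_transpose_def vec_eq_iff)

lemma conj_transpose_adjoint:
  fixes M :: "complex^'n^'m"
  shows "(M *v x) \<bullet> y = x \<bullet> (conj_transpose M *v y)"
proof -
  have "(\<Sum>i\<in>UNIV. \<Sum>j\<in>UNIV. cnj (M $ i $ j) * cnj (x $ j) * y $ i)
      = (\<Sum>j\<in>UNIV. \<Sum>i\<in>UNIV. cnj (M $ i $ j) * cnj (x $ j) * y $ i)"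
    by (rule sum.swap)
  then show ?thesis
    unfolding inner_eq_Re_sum
    by (simp add: matrix_vector_mult_def conj_transpose_def sum_distrib_left sum_distrib_right
        cnj_sum mult_ac)
qed

lemma hermitian_inner: "hermitian M \<Longrightarrow> (M *v x) \<bullet> y = x \<bullet> (M *v y)"
  using conj_transpose_adjoint[of M] by (simp add: hermitian_def)

lemma hermitian_psd_iff: "hermitian_psd M \<longleftrightarrow> hermitian M \<and> (\<forall>x. 0 \<le> x \<bullet> (M *v x))"
  by (simp add: hermitian_psd_def inner_eq_Re_sum)

section \<open>Existence of the Moore-Penrose inverse\<close>

lemma conj_transpose_mult_cancel_left:
  fixes M :: "complex^'n^'m" and Y Z :: "complex^'k^'n"
  assumes "conj_transpose M ** (M ** Y) = conj_transpose M ** (M ** Z)"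
  shows "M ** Y = M ** Z"
proof -
  have "M *v (Y *v x) = M *v (Z *v x)" for x
  proof -
    let ?d = "Y *v x - Z *v x"
    have "conj_transpose M *v (M *v (Y *v x)) = conj_transpose M *v (M *v (Z *v x))"
      using arg_cong[OF assms, of "\<lambda>N. N *v x"] by (simp add: matrix_vector_mul_assoc)
    then have "conj_transpose M *v (M *v ?d) = 0"
      by (simp add: matrix_vector_mult_diff_distrib)
    \<comment> \<open>Moving \<open>M\<close> across the inner product turns \<open>|M d|^2\<close>
      into \<open>d . M^* M d\<close>.\<close>
    then have "(M *v ?d) \<bullet> (M *v ?d) = 0"
      by (simp add: conj_transpose_adjoint)
    then show ?thesis
      by (simp add: matrix_vector_mult_diff_distrib)
  qed
  then show ?thesis
    by (simp add: matrix_eq flip: matrix_vector_mul_assoc)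
qed

lemma conj_transpose_mult_cancel_right:
  fixes M :: "complex^'n^'m" and Y Z :: "complex^'m^'k"
  assumes "Y ** M ** conj_transpose M = Z ** M ** conj_transpose M"
  shows "Y ** M = Z ** M"
proof -
  have "conj_transpose M ** conj_transpose Y = conj_transpose M ** conj_transpose Z"
    by (rule conj_transpose_mult_cancel_left)
      (use arg_cong[OF assms, of conj_transpose] in \<open>simp add: conj_transpose_mult\<close>)
  then show ?thesis
    by (metis conj_transpose_conj_transpose conj_transpose_mult)
qed

text \<open>A linear map has a linear right inverse on its range; its matrix serves as
  \<open>Y\<close>.\<close>

lemma exists_generalized_inverse:
  fixes M :: "'a::field^'n^'m"
  obtains Y :: "'a^'m^'n" where "M ** Y ** M = M"
proof -
  obtain g where g: "Vector_Spaces.linear (*s) (*s) g" "\<And>v. v \<in> range ((*v) M) \<Longrightarrow> M *v (g v) = v"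
    using vec.linear_exists_right_inverse_on[OF matrix_vector_mul_linear_gen vec.subspace_UNIV, of M]
    by blast
  have "M ** matrix g ** M = M"
    using g by (simp add: matrix_eq matrix_works flip: matrix_vector_mul_assoc)
  then show thesis
    by (rule that)
qed

text \<open>Zlobec's formula: \<open>H ** Y ** H\<close> works for every generalized inverse
  \<open>Y\<close> of \<open>H ** M ** H\<close>. Cancelling the outer \<open>H\<close> on each side
  yields \<open>M ** N ** M = M\<close>.\<close>

lemma exists_moore_penrose:
  fixes M :: "complex^'n^'m"
  shows "\<exists>N. is_moore_penrose M N"
proof -
  define H where "H = conj_transpose M"
  have ctM: "conj_transpose M = H" and ctH: "conj_transpose H = M"
    by (simp_all add: H_def)
  note ct = conj_transpose_mult ctM ctH
  obtain Y where Y: "(H ** M ** H) ** Y ** (H ** M ** H) = H ** M ** H"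
    by (rule exists_generalized_inverse)
  define N where "N = H ** Y ** H"
  have MNMH: "M ** (N ** M ** H) = M ** H"
    by (rule conj_transpose_mult_cancel_left) (use Y in \<open>simp add: N_def ctM matrix_mul_assoc\<close>)
  have "(M ** N) ** M = mat 1 ** M"
    by (rule conj_transpose_mult_cancel_right)
      (use MNMH in \<open>simp add: ctM matrix_mul_assoc\<close>)
  then have MNM: "M ** N ** M = M"
    by simp
  define P where "P = M ** N"
  define Q where "Q = N ** M"
  have PM: "P ** M = M" and MQ: "M ** Q = M"
    using MNM by (simp_all add: P_def Q_def matrix_mul_assoc)
  \<comment> \<open>\<open>conj_transpose P\<close> has left factor \<open>M\<close>, which
    \<open>P\<close> fixes, so it equals \<open>P ** conj_transpose P\<close>, a Hermitian matrix.
    The argument for \<open>Q\<close> mirrors this.\<close>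
  have "conj_transpose P = M ** conj_transpose (M ** H ** Y)"
    by (simp add: P_def N_def ct matrix_mul_assoc)
  then have P: "P ** conj_transpose P = conj_transpose P"
    by (simp add: PM matrix_mul_assoc)
  have "conj_transpose Q = conj_transpose (Y ** H ** M) ** M"
    by (simp add: Q_def N_def ct matrix_mul_assoc)
  then have Q: "conj_transpose Q ** Q = conj_transpose Q"
    by (simp add: MQ flip: matrix_mul_assoc)
  have hP: "conj_transpose P = P" and hQ: "conj_transpose Q = Q"
    using P Q by (metis conj_transpose_mult conj_transpose_conj_transpose)+
  \<comment> \<open>\<open>N\<close> has left factor \<open>H\<close>, so \<open>Q\<close> fixing
    \<open>H\<close> yields \<open>N ** M ** N = N\<close>.\<close>
  have "Q ** H = H"
    using arg_cong[OF MQ, of conj_transpose] by (simp add: ct hQ)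
  then have "Q ** N = N"
    by (simp add: N_def matrix_mul_assoc)
  then show ?thesis
    using MNM hP hQ unfolding is_moore_penrose_def P_def Q_def by blast
qed

lemma is_moore_penrose_moore_penrose: "is_moore_penrose M (moore_penrose M)"
  by (metis exists_moore_penrose moore_penrose_eqI)

text \<open>Conjugate transposition permutes the Penrose equations of a Hermitian \<open>M\<close>,
  so uniqueness applies.\<close>

lemma hermitian_moore_penrose:
  assumes "hermitian M"
  shows "hermitian (moore_penrose M)"
proof -
  have "is_moore_penrose M (conj_transpose (moore_penrose M))"
    using is_moore_penrose_moore_penrose[of M] assms
    unfolding is_moore_penrose_def hermitian_def
    by (metis conj_transpose_mult matrix_mul_assoc)
  then show ?thesis
    using moore_penrose_eqI unfolding hermitian_def by metis
qed

section \<open>Quadratic forms and the spectral norm\<close>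

lemma hermitian_psd_add:
  assumes "hermitian_psd M" "hermitian_psd N"
  shows "hermitian_psd (M + N)"
  using assms
  by (simp add: hermitian_psd_iff hermitian_def conj_transpose_add matrix_vector_mult_add_rdistrib
      inner_add_right)

text \<open>Positivity of the form at \<open>z - t (M z)\<close> with \<open>t = 1 / c\<close>
  replaces an appeal to the spectral theorem.\<close>

lemma inner_mult_self_le_if_form_le:
  assumes M: "hermitian_psd M" and "0 \<le> c"
    and le: "\<And>x. x \<bullet> (M *v x) \<le> c * (x \<bullet> x)"
  shows "(M *v z) \<bullet> (M *v z) \<le> c * (z \<bullet> (M *v z))"
proof -
  let ?w = "M *v z"
  have sym: "z \<bullet> (M *v ?w) = ?w \<bullet> ?w"
    using M hermitian_inner[of M z ?w] by (simp add: hermitian_psd_iff)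
  have form: "0 \<le> z \<bullet> ?w - 2 * t * (?w \<bullet> ?w) + t\<^sup>2 * (?w \<bullet> (M *v ?w))" for t
  proof -
    have "0 \<le> (z - t *\<^sub>R ?w) \<bullet> (M *v (z - t *\<^sub>R ?w))"
      using M by (simp add: hermitian_psd_iff)
    also have "\<dots> = z \<bullet> ?w - 2 * t * (?w \<bullet> ?w) + t\<^sup>2 * (?w \<bullet> (M *v ?w))"
      by (simp add: matrix_vector_mult_diff_distrib linear_scale[OF matrix_vector_mul_linear]
          inner_diff_left inner_diff_right sym power2_eq_square algebra_simps)
    finally show ?thesis .
  qed
  show ?thesis
  proof (cases "c = 0")
    case True
    \<comment> \<open>Here \<open>t = 1\<close> suffices: the first and last terms of
      \<open>form\<close> are at most 0.\<close>
    then show ?thesis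
      using form[of 1] le[of z] le[of ?w] by simp
  next
    case False
    then have c: "c > 0" using \<open>0 \<le> c\<close> by simp
    have "(1/c)\<^sup>2 * (?w \<bullet> (M *v ?w)) \<le> (1/c)\<^sup>2 * (c * (?w \<bullet> ?w))"
      by (intro mult_left_mono le) simp
    then have "(1/c) * (?w \<bullet> ?w) \<le> z \<bullet> ?w"
      using form[of "1/c"] c by (simp add: power2_eq_square)
    then show ?thesis
      using c by (simp add: field_simps)
  qed
qed

text \<open>The form bound enters twice: \<open>|M z|^2 <= c (z . M z) <= c^2 |z|^2\<close>.\<close>

lemma spectral_norm_psd_le:
  assumes "hermitian_psd M" and "0 \<le> c"
    and le: "\<And>x. x \<bullet> (M *v x) \<le> c * (x \<bullet> x)"
  shows "spectral_norm M \<le> c"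
  unfolding spectral_norm_def
proof (rule onorm_bound)
  fix z
  have "(norm (M *v z))\<^sup>2 \<le> c * (z \<bullet> (M *v z))"
    using inner_mult_self_le_if_form_le[OF assms] by (simp add: power2_norm_eq_inner)
  also have "\<dots> \<le> c * (c * (z \<bullet> z))"
    using assms by (intro mult_left_mono) auto
  also have "\<dots> = (c * norm z)\<^sup>2"
    by (simp add: power_mult_distrib power2_norm_eq_inner) (simp add: power2_eq_square)
  finally show "norm (M *v z) \<le> c * norm z"
    by (rule power2_le_imp_le) (simp add: \<open>0 \<le> c\<close>)
qed fact

lemma norm_mult_le_spectral_norm: "norm (M *v x) \<le> spectral_norm M * norm x"
  unfolding spectral_norm_def by (rule onorm) simp

lemma spectral_norm_nonneg: "0 \<le> spectral_norm M"
  unfolding spectral_norm_def by (rule onorm_pos_le) simp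

lemma spectral_norm_mult_le: "spectral_norm (M ** N) \<le> spectral_norm M * spectral_norm N"
  unfolding spectral_norm_def
  using onorm_compose[OF matrix_vector_mul_bounded_linear matrix_vector_mul_bounded_linear, of M N]
  by (simp add: o_def matrix_vector_mul_assoc)

lemma form_le_spectral_norm: "x \<bullet> (M *v x) \<le> spectral_norm M * (x \<bullet> x)"
proof -
  have "x \<bullet> (M *v x) \<le> norm x * norm (M *v x)"
    by (rule norm_cauchy_schwarz)
  also have "\<dots> \<le> norm x * (spectral_norm M * norm x)"
    by (intro mult_left_mono norm_mult_le_spectral_norm) simp
  finally show ?thesis
    by (simp add: dot_square_norm power2_eq_square mult_ac)
qed

text \<open>Cauchy-Schwarz bounds \<open>|M^* y|^2 = (M M^* y) . y\<close>, and one factor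
  \<open>|M^* y|\<close> cancels.\<close>

lemma spectral_norm_conj_transpose_le: "spectral_norm (conj_transpose M) \<le> spectral_norm M"
  unfolding spectral_norm_def[of "conj_transpose M"]
proof (rule onorm_bound)
  fix y
  let ?z = "conj_transpose M *v y"
  have "norm ?z * norm ?z = (M *v ?z) \<bullet> y"
    by (simp add: conj_transpose_adjoint flip: power2_norm_eq_inner power2_eq_square)
  also have "\<dots> \<le> norm (M *v ?z) * norm y"
    by (rule norm_cauchy_schwarz)
  also have "\<dots> \<le> spectral_norm M * norm ?z * norm y"
    by (intro mult_right_mono norm_mult_le_spectral_norm) simp
  finally have "norm ?z * norm ?z \<le> (spectral_norm M * norm y) * norm ?z"
    by (simp add: mult_ac)
  then show "norm ?z \<le> spectral_norm M * norm y"
    by (cases "norm ?z = 0") (auto simp: spectral_norm_nonneg)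
qed (rule spectral_norm_nonneg)

lemma psd_mult_eq_0:
  assumes "hermitian_psd M" and "z \<bullet> (M *v z) = 0"
  shows "M *v z = 0"
  using inner_mult_self_le_if_form_le[OF assms(1) spectral_norm_nonneg form_le_spectral_norm, of z] assms(2)
  by (simp flip: power2_norm_eq_inner)

text \<open>Two nonnegative forms with sum 0 both vanish, and a vanishing semidefinite form puts
  \<open>z\<close> in the kernel.\<close>

lemma psd_add_mult_eq_0:
  assumes P: "hermitian_psd P" and Q: "hermitian_psd Q" and "(P + Q) *v z = 0"
  shows "Q *v z = 0"
proof (rule psd_mult_eq_0[OF Q])
  have "z \<bullet> (P *v z) + z \<bullet> (Q *v z) = 0"
    using assms(3) by (simp flip: inner_add_right matrix_vector_mult_add_rdistrib)
  then show "z \<bullet> (Q *v z) = 0"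
    using P Q by (simp add: hermitian_psd_iff add_nonneg_eq_0_iff)
qed

section \<open>The parallel sum and its quadratic form\<close>

lemma matrix_diff_ldistrib: "A ** (B - C) = A ** B - A ** (C :: 'a::ring_1^'n^'m)"
  by (simp add: matrix_matrix_mult_def vec_eq_iff right_diff_distrib sum_subtractf)

lemma matrix_diff_rdistrib: "(A - B) ** C = A ** C - B ** (C :: 'a::ring_1^'n^'m)"
  by (simp add: matrix_matrix_mult_def vec_eq_iff left_diff_distrib sum_subtractf)

lemma psd_mult_moore_penrose:
  assumes P: "hermitian_psd P" and Q: "hermitian_psd Q"
  shows "Q ** moore_penrose (P + Q) ** (P + Q) = Q"
    and "(P + Q) ** moore_penrose (P + Q) ** Q = Q"
proof -
  define T where "T = P + Q"
  define N where "N = moore_penrose T"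
  have "T ** N ** T = T"
    using is_moore_penrose_moore_penrose[of T] by (simp add: is_moore_penrose_def N_def)
  then have "T *v (N *v (T *v x)) = T *v x" for x
    by (simp add: matrix_vector_mul_assoc matrix_mul_assoc)
  \<comment> \<open>\<open>N T x - x\<close> lies in the kernel of \<open>T\<close>, hence in that
    of \<open>Q\<close>; the second identity is the adjoint of the first.\<close>
  then have "T *v (N *v (T *v x) - x) = 0" for x
    by (simp add: matrix_vector_mult_diff_distrib)
  then have "Q *v (N *v (T *v x) - x) = 0" for x
    using psd_add_mult_eq_0[OF P Q] by (simp add: T_def)
  then have QNT: "Q ** N ** T = Q"
    by (simp add: matrix_eq matrix_vector_mult_diff_distrib flip: matrix_vector_mul_assoc)
  have hT: "hermitian T"
    using hermitian_psd_add[OF P Q] by (simp add: T_def hermitian_psd_def)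
  then have "conj_transpose N = N" "conj_transpose T = T" "conj_transpose Q = Q"
    using hermitian_moore_penrose[OF hT] Q by (simp_all add: N_def hermitian_def hermitian_psd_def)
  then have "T ** N ** Q = Q"
    using arg_cong[OF QNT, of conj_transpose] by (simp add: conj_transpose_mult matrix_mul_assoc)
  with QNT show "Q ** moore_penrose (P + Q) ** (P + Q) = Q"
    and "(P + Q) ** moore_penrose (P + Q) ** Q = Q"
    by (simp_all add: T_def N_def)
qed

text \<open>Writing \<open>P\<close> as \<open>(P + Q) - Q\<close> leaves \<open>P\<close> only
  inside the inverse, so the bare \<open>Q\<close> cancels in a difference of parallel sums with the
  same \<open>Q\<close>.\<close>

lemma parallel_sum_eq:
  assumes "hermitian_psd P" "hermitian_psd Q"
  shows "parallel_sum P Q = Q - Q ** moore_penrose (P + Q) ** Q"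
proof -
  have "parallel_sum P Q = ((P + Q) - Q) ** moore_penrose (P + Q) ** Q"
    by (simp add: parallel_sum_def)
  then show ?thesis
    unfolding matrix_diff_rdistrib psd_mult_moore_penrose(2)[OF assms] .
qed

text \<open>The minimum over \<open>u\<close> of the upper bound is attained at
  \<open>w = (P + Q)\<^sup>\<dagger> Q z\<close>, where \<open>P w = Q (z - w)\<close>.\<close>

lemma parallel_sum_form:
  assumes P: "hermitian_psd P" and Q: "hermitian_psd Q"
  shows parallel_sum_form_nonneg: "0 \<le> z \<bullet> (parallel_sum P Q *v z)"
    and parallel_sum_form_le:
      "z \<bullet> (parallel_sum P Q *v z) \<le> u \<bullet> (P *v u) + (z - u) \<bullet> (Q *v (z - u))"
proof -
  define w where "w = moore_penrose (P + Q) *v (Q *v z)"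
  define v where "v = u - w"
  have R: "parallel_sum P Q *v z = P *v w"
    by (simp add: parallel_sum_def w_def matrix_vector_mul_assoc matrix_mul_assoc)
  have "(P + Q) *v w = Q *v z"
    using psd_mult_moore_penrose(2)[OF P Q] by (simp add: w_def matrix_vector_mul_assoc matrix_mul_assoc)
  then have w: "Q *v (z - w) = P *v w"
    by (simp add: matrix_vector_mult_diff_distrib matrix_vector_mult_add_rdistrib algebra_simps)
  have psd: "0 \<le> x \<bullet> (P *v x)" "0 \<le> x \<bullet> (Q *v x)" for x
    using P Q by (simp_all add: hermitian_psd_iff)
  \<comment> \<open>Since \<open>P *v w\<close> is also \<open>Q *v (z - w)\<close>, the form at
    \<open>z\<close> is the upper bound evaluated at \<open>u = w\<close>.\<close>
  have split: "z \<bullet> (P *v w) = w \<bullet> (P *v w) + (z - w) \<bullet> (Q *v (z - w))"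
    by (simp add: w flip: inner_add_left)
  then show "0 \<le> z \<bullet> (parallel_sum P Q *v z)"
    using psd(1)[of w] psd(2)[of "z - w"] by (simp add: R)
  have symP: "w \<bullet> (P *v v) = v \<bullet> (P *v w)"
    using P hermitian_inner[of P w v] by (simp add: hermitian_psd_iff inner_commute)
  have symQ: "(z - w) \<bullet> (Q *v v) = v \<bullet> (P *v w)"
    using Q hermitian_inner[of Q "z - w" v] w by (simp add: hermitian_psd_iff inner_commute)
  have u: "u = w + v" and zu: "z - u = (z - w) - v"
    by (simp_all add: v_def)
  \<comment> \<open>Expanding at \<open>w\<close>, the terms linear in \<open>v\<close> cancel and
    the nonnegative forms of \<open>v\<close> remain.\<close>
  have "u \<bullet> (P *v u) = w \<bullet> (P *v w) + 2 * (v \<bullet> (P *v w)) + v \<bullet> (P *v v)"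
    by (simp add: u inner_add_left inner_add_right matrix_vector_right_distrib symP)
  moreover have "(z - u) \<bullet> (Q *v (z - u))
      = (z - w) \<bullet> (Q *v (z - w)) - 2 * (v \<bullet> (P *v w)) + v \<bullet> (Q *v v)"
    unfolding zu matrix_vector_mult_diff_distrib[of Q "z - w" v] inner_diff_left[of "z - w" v]
      inner_diff_right w symQ by simp
  ultimately show "z \<bullet> (parallel_sum P Q *v z) \<le> u \<bullet> (P *v u) + (z - u) \<bullet> (Q *v (z - u))"
    using psd(1)[of v] psd(2)[of v] by (simp add: R split)
qed

text \<open>The defining product is not visibly Hermitian; the difference in
  \<open>parallel_sum_eq\<close> is.\<close>

lemma hermitian_psd_parallel_sum:
  assumes P: "hermitian_psd P" and Q: "hermitian_psd Q"
  shows "hermitian_psd (parallel_sum P Q)"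
proof -
  have "hermitian (moore_penrose (P + Q))"
    using hermitian_moore_penrose hermitian_psd_add[OF P Q] unfolding hermitian_psd_def by blast
  then have "conj_transpose (Q ** moore_penrose (P + Q) ** Q) = Q ** moore_penrose (P + Q) ** Q"
    using Q by (simp add: hermitian_psd_def hermitian_def conj_transpose_mult matrix_mul_assoc)
  moreover have "conj_transpose (M - N) = conj_transpose M - conj_transpose N" for M N :: "complex^'a^'a"
    by (simp add: conj_transpose_def vec_eq_iff)
  ultimately have "hermitian (parallel_sum P Q)"
    using Q by (simp add: hermitian_def hermitian_psd_def parallel_sum_eq[OF P Q])
  then show ?thesis
    using parallel_sum_form_nonneg[OF P Q] by (simp add: hermitian_psd_iff)
qed

text \<open>Where both norms vanish, the bound and \<open>t\<close> below are the junk value \<open>0 / 0 = 0\<close>.\<close>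

lemma spectral_norm_parallel_sum_le:
  assumes P: "hermitian_psd P" and Q: "hermitian_psd Q"
  shows "spectral_norm (parallel_sum P Q)
    \<le> spectral_norm P * spectral_norm Q / (spectral_norm P + spectral_norm Q)"
proof (rule spectral_norm_psd_le[OF hermitian_psd_parallel_sum[OF P Q]])
  let ?p = "spectral_norm P" and ?q = "spectral_norm Q"
  note nonneg = spectral_norm_nonneg[of P] spectral_norm_nonneg[of Q]
  then show "0 \<le> ?p * ?q / (?p + ?q)" by simp
  fix z
  \<comment> \<open>For a nonzero denominator this \<open>t\<close> minimizes
    \<open>t^2 p + (1 - t)^2 q\<close>.\<close>
  define t where "t = ?q / (?p + ?q)"
  have coeff: "t\<^sup>2 * ?p + (1 - t)\<^sup>2 * ?q = ?p * ?q / (?p + ?q)"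
  proof (cases "?p + ?q = 0")
    case True
    then show ?thesis using nonneg by (simp add: t_def)
  next
    case False
    then have "1 - t = ?p / (?p + ?q)" by (simp add: t_def field_simps)
    then have "t\<^sup>2 * ?p + (1 - t)\<^sup>2 * ?q = (?q\<^sup>2 * ?p + ?p\<^sup>2 * ?q) / (?p + ?q)\<^sup>2"
      by (simp only: t_def power_divide add_divide_distrib times_divide_eq_left)
    also have "?q\<^sup>2 * ?p + ?p\<^sup>2 * ?q = ?p * ?q * (?p + ?q)"
      by (simp add: power2_eq_square algebra_simps)
    also have "?p * ?q * (?p + ?q) / (?p + ?q)\<^sup>2 = ?p * ?q / (?p + ?q)"
      using False by (simp add: power2_eq_square)
    finally show ?thesis .
  qed
  have "z \<bullet> (parallel_sum P Q *v z)
      \<le> (t *\<^sub>R z) \<bullet> (P *v (t *\<^sub>R z)) + (z - t *\<^sub>R z) \<bullet> (Q *v (z - t *\<^sub>R z))"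
    by (rule parallel_sum_form_le[OF P Q])
  also have "z - t *\<^sub>R z = (1 - t) *\<^sub>R z"
    by (simp add: scaleR_left_diff_distrib)
  also have "(t *\<^sub>R z) \<bullet> (P *v (t *\<^sub>R z)) + ((1 - t) *\<^sub>R z) \<bullet> (Q *v ((1 - t) *\<^sub>R z))
      = t\<^sup>2 * (z \<bullet> (P *v z)) + (1 - t)\<^sup>2 * (z \<bullet> (Q *v z))"
    by (simp add: linear_scale[OF matrix_vector_mul_linear] power2_eq_square)
  also have "\<dots> \<le> t\<^sup>2 * (?p * (z \<bullet> z)) + (1 - t)\<^sup>2 * (?q * (z \<bullet> z))"
    by (intro add_mono mult_left_mono form_le_spectral_norm) simp_all
  also have "\<dots> = ?p * ?q / (?p + ?q) * (z \<bullet> z)"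
    unfolding coeff[symmetric] by (simp add: algebra_simps)
  finally show "z \<bullet> (parallel_sum P Q *v z) \<le> ?p * ?q / (?p + ?q) * (z \<bullet> z)" .
qed

section \<open>The perturbation and its norm\<close>

lemma parallel_sum_perturbation_eq:
  fixes A B X :: "complex^'n^'n"
  assumes A: "hermitian_psd A" and B: "hermitian_psd B" and X: "hermitian_psd X"
  defines "K \<equiv> moore_penrose (A + B) ** B"
  shows "parallel_sum (A + X) B - parallel_sum A B
    = conj_transpose K ** parallel_sum X (A + B) ** K"
proof -
  define S where "S = A + B"
  define N where "N = moore_penrose S"
  define L where "L = moore_penrose (X + S)"
  have S: "hermitian_psd S"
    unfolding S_def by (rule hermitian_psd_add[OF A B])
  then have "hermitian S" "hermitian N"
    using hermitian_moore_penrose by (auto simp: hermitian_psd_def N_def)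
  then have ctK: "conj_transpose K = B ** N"
    using B by (simp add: K_def N_def S_def conj_transpose_mult hermitian_def hermitian_psd_def)
  have SK: "S ** K = B" and KS: "B ** N ** S = B"
    using psd_mult_moore_penrose[OF A B] by (simp_all add: K_def N_def S_def matrix_mul_assoc)
  \<comment> \<open>\<open>conj_transpose K ** S\<close> and \<open>S ** K\<close> are both
    \<open>B\<close>, so the outer factors turn \<open>S - S L S\<close> into
    \<open>B K - B L B\<close>; adding and subtracting \<open>B\<close> then exposes the two
    parallel sums.\<close>
  have "B ** N ** (S - S ** L ** S) ** K = B ** N ** S ** K - B ** N ** S ** L ** (S ** K)"
    by (simp add: matrix_diff_ldistrib matrix_diff_rdistrib matrix_mul_assoc)
  also have "\<dots> = B ** K - B ** L ** B"
    by (simp only: KS SK)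
  also have "\<dots> = (B - B ** L ** B) - (B - B ** N ** B)"
    by (simp add: K_def N_def S_def matrix_mul_assoc)
  also have "\<dots> = parallel_sum (A + X) B - parallel_sum A B"
    using parallel_sum_eq[OF A B] parallel_sum_eq[OF hermitian_psd_add[OF A X] B]
    by (simp add: L_def N_def S_def ac_simps)
  finally show ?thesis
    using parallel_sum_eq[OF X S] by (simp add: ctK L_def S_def)
qed

theorem corollary3p2:
  fixes A B X G :: "complex^'n^'n"
  assumes "hermitian_psd A" and "hermitian_psd B" and "hermitian_psd X"
    and "G = parallel_sum (A + X) B - parallel_sum A B"
  shows "spectral_norm G \<le>
    (if spectral_norm (A + B) + spectral_norm X = 0 then 0
     else (spectral_norm (moore_penrose (A + B) ** B))\<^sup>2 * spectral_norm (A + B) * spectral_norm X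
          / (spectral_norm (A + B) + spectral_norm X))"
proof -
  let ?K = "moore_penrose (A + B) ** B" and ?R = "parallel_sum X (A + B)"
  let ?s = "spectral_norm (A + B)" and ?x = "spectral_norm X"
  have "spectral_norm G = spectral_norm (conj_transpose ?K ** ?R ** ?K)"
    using assms parallel_sum_perturbation_eq by metis
  also have "\<dots> \<le> spectral_norm (conj_transpose ?K ** ?R) * spectral_norm ?K"
    by (rule spectral_norm_mult_le)
  also have "\<dots> \<le> (spectral_norm (conj_transpose ?K) * spectral_norm ?R) * spectral_norm ?K"
    by (intro mult_right_mono spectral_norm_mult_le spectral_norm_nonneg)
  also have "\<dots> \<le> (spectral_norm ?K * (?x * ?s / (?x + ?s))) * spectral_norm ?K"
    by (intro mult_right_mono mult_mono spectral_norm_conj_transpose_le spectral_norm_nonneg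
        spectral_norm_parallel_sum_le hermitian_psd_add assms)
  also have "\<dots> = (spectral_norm ?K)\<^sup>2 * ?s * ?x / (?s + ?x)"
    by (simp add: power2_eq_square mult_ac add.commute)
  \<comment> \<open>A zero denominator makes the quotient 0, as the first branch requires.\<close>
  finally show ?thesis
    by auto
qed

end
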